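(* Let $\mathcal{J}: B_e^n \to \mathbb{R}$ be a shape functional. Then $\mathcal{J}$ has a canonical extension to a pre-shape functional $$\mathfrak{J}: \operatorname{Emb}(M,\mathbb{R}^{n+1}) \to \mathbb{R}, \qquad \varphi \mapsto \mathcal{J}(\pi(\varphi)).$$ Further, there is a one-to-one correspondence (given by $\mathcal{J} \mapsto \mathcal{J}\circ\pi$) between shape functionals $\mathcal{J}: B_e^n \to \mathbb{R}$ and pre-shape functionals $\mathfrak{J}: \operatorname{Emb}(M,\mathbb{R}^{n+1})\to\mathbb{R}$ having shape functionality. Additionally, if $\mathcal{J}$ is shape differentiable in the classical sense, then its extension $\mathfrak{J} = \mathcal{J}\circ\pi$ is pre-shape differentiable.
   Context: $M$ is an $n$-dimensional, orientable, path-connected, compact $C^\infty$-manifold. $\operatorname{Emb}(M,\mathbb{R}^{n+1})$ is the space of $C^\infty$-embeddings (injective smooth immersions) $\varphi: M\to\mathbb{R}^{n+1}$. $\operatorname{Diff}(M)$ is the group of $C^\infty$-diffeomorphisms of $M$ onto itself, acting on $\operatorname{Emb}(M,\mathbb{R}^{n+1})$ from the right by $\varphi\mapsto\varphi\circ\rho$. $B_e^n := \operatorname{Emb}(M,\mathbb{R}^{n+1})/\operatorname{Diff}(M)$, and $\pi: \operatorname{Emb}(M,\mathbb{R}^{n+1})\to B_e^n$ is the quotient map. An element $\pi(\varphi)\in B_e^n$ is identified with the subset $\varphi(M)\subset\mathbb{R}^{n+1}$. A shape functional is a function $\mathcal{J}: B_e^n\to\mathbb{R}$; a pre-shape functional is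 a function $\mathfrak{J}:\operatorname{Emb}(M,\mathbb{R}^{n+1})\to\mathbb{R}$. A pre-shape functional $\mathfrak{J}$ has shape functionality if $\mathfrak{J}(\varphi\circ\rho)=\mathfrak{J}(\varphi)$ for all $\varphi\in\operatorname{Emb}(M,\mathbb{R}^{n+1})$ and $\rho\in\operatorname{Diff}(M)$. For $V\in C^\infty(\mathbb{R}^{n+1},\mathbb{R}^{n+1})$ and $\varphi\in\operatorname{Emb}(M,\mathbb{R}^{n+1})$, the perturbation of identity is $\varphi_t := \varphi + t\cdot V\circ\varphi$ for $t\in[0,\tau)$ with some $\tau>0$. The pre-shape derivative of $\mathfrak{J}$ at $\varphi$ in direction $V$ is $$\mathfrak{D}\mathfrak{J}(\varphi)[V] := \lim_{t\downarrow 0}\frac{\mathfrak{J}(\varphi_t)-\mathfrak{J}(\varphi)}{t},$$ if it exists and is linear and bounded (continuous) in $V$. $\mathfrak{J}$ is pre-shape differentiable if its pre-shape derivative exists. For a shape $\Gamma_0\subset\mathbb{R}^{n+1}$, put $\Gamma_t := \{x_0+tV(x_0): x_0\in\Gamma_0\}$. The classical shape derivative is $\mathcal{D}\mathcal{J}(\Gamma_0)[V] := \lim_{t\downarrow 0}\frac{\mathcal{J}(\Gamma_t)-\mathcal{J}(\Gamma_0)}{t}$, and $\mathcal{J}$ is shape differentiable if this limit exists for all $V$ and is linear and bounded in $V$. *)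

theory Defs
  imports "HOL-Analysis.Analysis"
begin

section \<open>Smooth functions between open subsets of normed spaces\<close>

text \<open>
  \<open>iter_deriv [v1, \<dots>, vk] f\<close> is the iterated directional derivative of \<open>f\<close>, taken first in
  direction \<open>v1\<close>, then \<open>v2\<close>, and so on.
\<close>

primrec iter_deriv ::
  "'e::real_normed_vector list \<Rightarrow> ('e \<Rightarrow> 'f::real_normed_vector) \<Rightarrow> 'e \<Rightarrow> 'f" where
  "iter_deriv [] f = f"
| "iter_deriv (v # vs) f = iter_deriv vs (\<lambda>x. frechet_derivative f (at x) v)"

text \<open>
  Meaningful for open \<open>S\<close> only: since the derivatives are two-sided, their values at points of an
  open \<open>S\<close> do not depend on \<open>f\<close> outside \<open>S\<close>.
\<close>

definition smooth_on ::
  "'e::real_normed_vector set \<Rightarrow> ('e \<Rightarrow> 'f::real_normed_vector) \<Rightarrow> bool" where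
  "smooth_on S f \<longleftrightarrow> (\<forall>vs. \<forall>x\<in>S. iter_deriv vs f differentiable at x)"


section \<open>Smooth manifolds\<close>

text \<open>
  A manifold without boundary is a topology \<open>M\<close> on the carrier \<open>topspace M\<close> together with a smooth
  atlas \<open>A\<close>. The atlas need not be maximal: smoothness of maps is unchanged
  when charts compatible with \<open>A\<close> are added.
\<close>

type_synonym ('a, 'n) chart = "'a set \<times> ('a \<Rightarrow> real ^ 'n)"

definition is_chart :: "'a topology \<Rightarrow> ('a, 'n::finite) chart \<Rightarrow> bool" where
  "is_chart M = (\<lambda>(U, x). openin M U \<and> open (x ` U) \<and>
     homeomorphic_map (subtopology M U) (top_of_set (x ` U)) x)"

definition transition ::
  "('a, 'n::finite) chart \<Rightarrow> ('a, 'n) chart \<Rightarrow> real ^ 'n \<Rightarrow> real ^ 'n" where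
  "transition c d = snd d \<circ> inv_into (fst c) (snd c)"

definition transition_dom ::
  "('a, 'n::finite) chart \<Rightarrow> ('a, 'n) chart \<Rightarrow> (real ^ 'n) set" where
  "transition_dom c d = snd c ` (fst c \<inter> fst d)"

definition smooth_atlas :: "'a topology \<Rightarrow> ('a, 'n::finite) chart set \<Rightarrow> bool" where
  "smooth_atlas M A \<longleftrightarrow>
     (\<forall>c\<in>A. is_chart M c) \<and> (\<Union>c\<in>A. fst c) = topspace M \<and>
     (\<forall>c\<in>A. \<forall>d\<in>A. smooth_on (transition_dom c d) (transition c d))"

definition smooth_manifold :: "'a topology \<Rightarrow> ('a, 'n::finite) chart set \<Rightarrow> bool" where
  "smooth_manifold M A \<longleftrightarrow> Hausdorff_space M \<and> second_countable M \<and> smooth_atlas M A"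

definition orientable :: "'a topology \<Rightarrow> ('a, 'n::finite) chart set \<Rightarrow> bool" where
  "orientable M A \<longleftrightarrow>
     (\<exists>B. smooth_atlas M B \<and> smooth_atlas M (A \<union> B) \<and>
        (\<forall>c\<in>B. \<forall>d\<in>B. \<forall>x\<in>transition_dom c d. det (jacobian (transition c d) (at x)) > 0))"

definition smooth_map ::
  "'a topology \<Rightarrow> ('a, 'n::finite) chart set \<Rightarrow> 'b topology \<Rightarrow> ('b, 'm::finite) chart set \<Rightarrow>
   ('a \<Rightarrow> 'b) \<Rightarrow> bool" where
  "smooth_map M A N B f \<longleftrightarrow> continuous_map M N f \<and>
     (\<forall>(U, x)\<in>A. \<forall>(W, y)\<in>B. smooth_on (x ` (U \<inter> f -` W)) (y \<circ> f \<circ> inv_into U x))"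

definition eucl_atlas :: "(real ^ 'm, 'm::finite) chart set" where
  "eucl_atlas = {(UNIV, id)}"


section \<open>Embeddings, diffeomorphisms and shapes\<close>

text \<open>
  Functions on \<open>topspace M\<close> are represented by extensional HOL functions (value \<open>undefined\<close>
  outside the carrier), so that equality of functions is equality on the carrier; the same
  convention is used below for functionals on embeddings and on shapes.
\<close>

definition immersion ::
  "('a, 'n::finite) chart set \<Rightarrow> ('a \<Rightarrow> real ^ 'm::finite) \<Rightarrow> bool" where
  "immersion A \<phi> \<longleftrightarrow>
     (\<forall>(U, x)\<in>A. \<forall>p\<in>U. inj (frechet_derivative (\<phi> \<circ> inv_into U x) (at (x p))))"

definition Emb ::
  "'a topology \<Rightarrow> ('a, 'n::finite) chart set \<Rightarrow> ('a \<Rightarrow> real ^ 'm::finite) set" where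
  "Emb M A = {\<phi> \<in> extensional (topspace M).
     inj_on \<phi> (topspace M) \<and> smooth_map M A euclidean eucl_atlas \<phi> \<and> immersion A \<phi>}"

definition Diff :: "'a topology \<Rightarrow> ('a, 'n::finite) chart set \<Rightarrow> ('a \<Rightarrow> 'a) set" where
  "Diff M A = {\<rho> \<in> extensional (topspace M).
     bij_betw \<rho> (topspace M) (topspace M) \<and>
     smooth_map M A M A \<rho> \<and> smooth_map M A M A (inv_into (topspace M) \<rho>)}"

definition reparam ::
  "'a topology \<Rightarrow> ('a, 'n::finite) chart set \<Rightarrow>
   (('a \<Rightarrow> real ^ 'm::finite) \<times> ('a \<Rightarrow> real ^ 'm)) set" where
  "reparam M A = {(\<phi>, \<psi>). \<phi> \<in> Emb M A \<and> \<psi> \<in> Emb M A \<and>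
     (\<exists>\<rho>\<in>Diff M A. \<psi> = compose (topspace M) \<phi> \<rho>)}"

type_synonym ('a, 'm) shape = "('a \<Rightarrow> real ^ 'm) set"

definition Be ::
  "'a topology \<Rightarrow> ('a, 'n::finite) chart set \<Rightarrow> ('a, 'm::finite) shape set" where
  "Be M A = Emb M A // reparam M A"

definition proj ::
  "'a topology \<Rightarrow> ('a, 'n::finite) chart set \<Rightarrow> ('a \<Rightarrow> real ^ 'm::finite) \<Rightarrow> ('a, 'm) shape" where
  "proj M A \<phi> = reparam M A `` {\<phi>}"

text \<open>
  The identification of \<open>proj M A \<phi>\<close> with the subset \<open>\<phi> ` topspace M\<close>: all representatives of a
  shape have the same image, and \<open>shape_of_set\<close> returns the shape with a given image. The latter is
  unique for compact \<open>M\<close>, where embeddings with the same image differ by a diffeomorphism.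
\<close>

definition shape_set :: "'a topology \<Rightarrow> ('a, 'm::finite) shape \<Rightarrow> (real ^ 'm) set" where
  "shape_set M b = (\<Union>\<phi>\<in>b. \<phi> ` topspace M)"

definition shape_of_set ::
  "'a topology \<Rightarrow> ('a, 'n::finite) chart set \<Rightarrow> (real ^ 'm::finite) set \<Rightarrow> ('a, 'm) shape" where
  "shape_of_set M A \<Gamma> = (THE b. b \<in> Be M A \<and> shape_set M b = \<Gamma>)"


section \<open>Shape functionals and pre-shape functionals\<close>

definition shape_functionals ::
  "'a topology \<Rightarrow> ('a, 'n::finite) chart set \<Rightarrow> (('a, 'm::finite) shape \<Rightarrow> real) set" where
  "shape_functionals M A = (Be M A \<rightarrow>\<^sub>E UNIV)"

definition preshape_functionals ::
  "'a topology \<Rightarrow> ('a, 'n::finite) chart set \<Rightarrow> (('a \<Rightarrow> real ^ 'm::finite) \<Rightarrow> real) set" where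
  "preshape_functionals M A = (Emb M A \<rightarrow>\<^sub>E UNIV)"

definition shape_functionality ::
  "'a topology \<Rightarrow> ('a, 'n::finite) chart set \<Rightarrow> (('a \<Rightarrow> real ^ 'm::finite) \<Rightarrow> real) \<Rightarrow> bool" where
  "shape_functionality M A F \<longleftrightarrow>
     (\<forall>\<phi>\<in>Emb M A. \<forall>\<rho>\<in>Diff M A. F (compose (topspace M) \<phi> \<rho>) = F \<phi>)"

definition canonical_extension ::
  "'a topology \<Rightarrow> ('a, 'n::finite) chart set \<Rightarrow> (('a, 'm::finite) shape \<Rightarrow> real) \<Rightarrow>
   ('a \<Rightarrow> real ^ 'm) \<Rightarrow> real" where
  "canonical_extension M A J = compose (Emb M A) J (proj M A)"


section \<open>Shape derivatives and pre-shape derivatives\<close>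

definition Cinf :: "(real ^ 'm::finite \<Rightarrow> real ^ 'm) set" where
  "Cinf = {V. smooth_on UNIV V}"

text \<open>The usual Frechet topology: uniform convergence of all derivatives on compact sets.\<close>

definition Cinf_topology :: "(real ^ 'm::finite \<Rightarrow> real ^ 'm) topology" where
  "Cinf_topology = topology_generated_by
     {{W \<in> Cinf. \<forall>x\<in>K. norm (iter_deriv vs W x - iter_deriv vs V x) < e} | V K vs e.
        V \<in> Cinf \<and> compact K \<and> (0::real) < e}"

definition bounded_linear_functional ::
  "((real ^ 'm::finite \<Rightarrow> real ^ 'm) \<Rightarrow> real) \<Rightarrow> bool" where
  "bounded_linear_functional D \<longleftrightarrow>
     (\<forall>V\<in>Cinf. \<forall>W\<in>Cinf. D (\<lambda>x. V x + W x) = D V + D W) \<and>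
     (\<forall>c. \<forall>V\<in>Cinf. D (\<lambda>x. c *\<^sub>R V x) = c * D V) \<and>
     continuous_map Cinf_topology euclideanreal D"

definition perturb ::
  "'a topology \<Rightarrow> (real ^ 'm::finite \<Rightarrow> real ^ 'm) \<Rightarrow> real \<Rightarrow> ('a \<Rightarrow> real ^ 'm) \<Rightarrow>
   'a \<Rightarrow> real ^ 'm" where
  "perturb M V t \<phi> = (\<lambda>p\<in>topspace M. \<phi> p + t *\<^sub>R V (\<phi> p))"

definition perturb_set ::
  "(real ^ 'm::finite \<Rightarrow> real ^ 'm) \<Rightarrow> real \<Rightarrow> (real ^ 'm) set \<Rightarrow> (real ^ 'm) set" where
  "perturb_set V t \<Gamma> = {x + t *\<^sub>R V x | x. x \<in> \<Gamma>}"

text \<open>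
  In both notions of derivative, the difference quotients involve the functional only on its
  domain for all small \<open>t > 0\<close>; this is part of the definition, so that no limit depends on values
  of a HOL function outside the domain of the functional.
\<close>

definition has_preshape_derivative ::
  "'a topology \<Rightarrow> ('a, 'n::finite) chart set \<Rightarrow> (('a \<Rightarrow> real ^ 'm::finite) \<Rightarrow> real) \<Rightarrow>
   ('a \<Rightarrow> real ^ 'm) \<Rightarrow> ((real ^ 'm \<Rightarrow> real ^ 'm) \<Rightarrow> real) \<Rightarrow> bool" where
  "has_preshape_derivative M A F \<phi> D \<longleftrightarrow> bounded_linear_functional D \<and>
     (\<forall>V\<in>Cinf. (\<forall>\<^sub>F t in at_right 0. perturb M V t \<phi> \<in> Emb M A) \<and>
        ((\<lambda>t. (F (perturb M V t \<phi>) - F \<phi>) / t) \<longlongrightarrow> D V) (at_right 0))"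

definition preshape_differentiable ::
  "'a topology \<Rightarrow> ('a, 'n::finite) chart set \<Rightarrow> (('a \<Rightarrow> real ^ 'm::finite) \<Rightarrow> real) \<Rightarrow> bool" where
  "preshape_differentiable M A F \<longleftrightarrow> (\<forall>\<phi>\<in>Emb M A. \<exists>D. has_preshape_derivative M A F \<phi> D)"

definition has_shape_derivative ::
  "'a topology \<Rightarrow> ('a, 'n::finite) chart set \<Rightarrow> (('a, 'm::finite) shape \<Rightarrow> real) \<Rightarrow>
   (real ^ 'm) set \<Rightarrow> ((real ^ 'm \<Rightarrow> real ^ 'm) \<Rightarrow> real) \<Rightarrow> bool" where
  "has_shape_derivative M A J \<Gamma> D \<longleftrightarrow> bounded_linear_functional D \<and>
     (\<forall>V\<in>Cinf. (\<forall>\<^sub>F t in at_right 0. perturb_set V t \<Gamma> \<in> shape_set M ` Be M A) \<and>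
        ((\<lambda>t. (J (shape_of_set M A (perturb_set V t \<Gamma>)) - J (shape_of_set M A \<Gamma>)) / t)
           \<longlongrightarrow> D V) (at_right 0))"

definition shape_differentiable ::
  "'a topology \<Rightarrow> ('a, 'n::finite) chart set \<Rightarrow> (('a, 'm::finite) shape \<Rightarrow> real) \<Rightarrow> bool" where
  "shape_differentiable M A J \<longleftrightarrow>
     (\<forall>\<Gamma>\<in>shape_set M ` Be M A. \<exists>D. has_shape_derivative M A J \<Gamma> D)"

end

theory Submission
  imports Defs
begin

text \<open>
  Everything rests on one geometric fact: for compact \<open>M\<close>, two embeddings have the same image if and
  only if they differ by a diffeomorphism (\<open>reparam_iff\<close>). So the reparametrization relation is
  ``same image'', hence an equivalence, and a shape is the same thing as an image set. Then
  \<open>J \<mapsto> J \<circ> \<pi>\<close> is a bijection because a functional with shape functionality is a functional that is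
  constant on the fibres of the surjection \<open>\<pi>\<close>. That \<open>J \<circ> \<pi>\<close> is invariant also needs \<open>\<phi> \<circ> \<rho>\<close> to be
  an embedding again, which is the chain rule in charts.

  The fact itself: if \<open>\<phi>\<close> and \<open>\<psi>\<close> have the same image, then \<open>\<rho> = \<phi>\<^sup>-\<^sup>1 \<circ> \<psi>\<close> is a bijection, and
  it is continuous because \<open>\<phi>\<close>, as a continuous map from a compact space to a Hausdorff space, is
  closed. In charts, \<open>\<rho>\<close> is a continuous map \<open>r\<close> with \<open>f \<circ> r = g\<close>, where \<open>f\<close> is an immersion and \<open>g\<close> is
  smooth. Such a map is smooth (\<open>smooth_on_lift\<close>): a left inverse of the derivative of \<open>f\<close> shows
  that \<open>r\<close> is differentiable, and then the normal equations of
  \<open>f'(r x) u = g'(x) v\<close> express \<open>u = r'(x) v\<close> rationally in terms of \<open>f' \<circ> r\<close> and \<open>g'\<close>. So \<open>r'\<close> is as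
  often differentiable as \<open>r\<close>, and induction applies.

  For the derivatives, let \<open>\<Gamma> = \<phi>(M)\<close>. The perturbation \<open>\<phi> + t V \<circ> \<phi>\<close> has the image \<open>\<Gamma>\<^sub>t\<close>, and for small
  \<open>t\<close> it is an embedding, because \<open>V\<close> is Lipschitz on the compact set \<open>\<Gamma>\<close> and has bounded
  derivative there, so that \<open>id + t V\<close> is injective on \<open>\<Gamma>\<close> with injective derivatives
  (\<open>perturb_eventually_Emb\<close>). Hence both difference quotients agree for small \<open>t\<close>, and the shape derivative of \<open>J\<close> at \<open>\<Gamma>\<close> is the pre-shape derivative of \<open>J \<circ> \<pi>\<close> at \<open>\<phi>\<close>.
\<close>

section \<open>Calculus of finitely often differentiable maps\<close>

text \<open>
  The closure properties of smooth maps are proved by induction on the order of differentiability.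
  The order \<open>0\<close> carries no condition, not even continuity, so that the induction starts trivially.
\<close>

primrec ndiff_on ::
  "nat \<Rightarrow> 'e::real_normed_vector set \<Rightarrow> ('e \<Rightarrow> 'f::real_normed_vector) \<Rightarrow> bool" where
  "ndiff_on 0 S f \<longleftrightarrow> True"
| "ndiff_on (Suc k) S f \<longleftrightarrow>
     (\<forall>x\<in>S. f differentiable at x) \<and> (\<forall>v. ndiff_on k S (\<lambda>x. frechet_derivative f (at x) v))"

text \<open>Both recursions peel off the first direction, so they match by induction. The \<open>k\<close>-th
  differentiation is that of a derivative of order \<open>k - 1\<close>, whence the strict inequality.\<close>

lemma ndiff_on_iff_iter_deriv:
  "ndiff_on k S f \<longleftrightarrow> (\<forall>vs. length vs < k \<longrightarrow> (\<forall>x\<in>S. iter_deriv vs f differentiable at x))"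
proof (induction k arbitrary: f)
  case (Suc k)
  have "(\<forall>vs. length vs < Suc k \<longrightarrow> (\<forall>x\<in>S. iter_deriv vs f differentiable at x)) \<longleftrightarrow>
     (\<forall>x\<in>S. f differentiable at x) \<and>
     (\<forall>v vs. length vs < k \<longrightarrow> (\<forall>x\<in>S. iter_deriv (v # vs) f differentiable at x))"
    (is "?L \<longleftrightarrow> ?R")
  proof
    assume L: ?L
    show ?R
      using L[rule_format, of "[]"] L[rule_format, of "_ # _"] by auto
  next
    assume R: ?R
    show ?L
    proof (intro allI impI)
      fix vs :: "'a list" assume "length vs < Suc k"
      then show "\<forall>x\<in>S. iter_deriv vs f differentiable at x"
        using R by (cases vs) auto
    qed
  qed
  then show ?case
    by (simp add: Suc.IH)
qed simp

lemma smooth_on_iff_ndiff_on: "smooth_on S f \<longleftrightarrow> (\<forall>k. ndiff_on k S f)"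
  unfolding smooth_on_def ndiff_on_iff_iter_deriv by blast

lemma has_derivative_frechet:
  "f differentiable at x \<Longrightarrow> (f has_derivative frechet_derivative f (at x)) (at x)"
  by (simp add: frechet_derivative_works)

lemma smooth_on_imp_differentiable: "smooth_on S f \<Longrightarrow> x \<in> S \<Longrightarrow> f differentiable at x"
  unfolding smooth_on_def by (metis iter_deriv.simps(1))

lemma ndiff_on_mono: "ndiff_on (Suc k) S f \<Longrightarrow> ndiff_on k S f"
  by (simp add: ndiff_on_iff_iter_deriv)

lemma ndiff_on_cong:
  assumes "open S" "\<And>x. x \<in> S \<Longrightarrow> f x = g x" "ndiff_on k S f"
  shows "ndiff_on k S g"
  using assms(2,3)
proof (induction k arbitrary: f g)
  case (Suc k)
  have g: "(g has_derivative frechet_derivative f (at x)) (at x)" if "x \<in> S" for x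
    by (rule has_derivative_transform_within_open[OF has_derivative_frechet assms(1) that])
      (use Suc.prems that in auto)
  moreover have "frechet_derivative f (at x) v = frechet_derivative g (at x) v" if "x \<in> S" for x v
    using frechet_derivative_at[OF g[OF that]] by simp
  then have "ndiff_on k S (\<lambda>x. frechet_derivative g (at x) v)" for v
    by (rule Suc.IH) (use Suc.prems(2) in \<open>simp_all only: ndiff_on.simps\<close>)
  ultimately show ?case
    by (auto simp: differentiable_def)
qed simp

text \<open>The workhorse of all inductions below: a formula for the derivative that holds on the open set
  \<open>S\<close> may be used in place of the canonical derivative.\<close>

lemma ndiff_on_SucI:
  assumes "open S" "\<And>x. x \<in> S \<Longrightarrow> (f has_derivative f' x) (at x)"
    and "\<And>v. ndiff_on k S (\<lambda>x. f' x v)"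
  shows "ndiff_on (Suc k) S f"
proof -
  have "f' x v = frechet_derivative f (at x) v" if "x \<in> S" for x v
    using frechet_derivative_at[OF assms(2)[OF that]] by simp
  then have "ndiff_on k S (\<lambda>x. frechet_derivative f (at x) v)" for v
    by (rule ndiff_on_cong[OF assms(1) _ assms(3)])
  moreover have "f differentiable at x" if "x \<in> S" for x
    using assms(2)[OF that] by (auto simp: differentiable_def)
  ultimately show ?thesis
    by simp
qed

lemma ndiff_on_SucD:
  assumes "ndiff_on (Suc k) S f"
  shows "x \<in> S \<Longrightarrow> (f has_derivative frechet_derivative f (at x)) (at x)"
    and "ndiff_on k S (\<lambda>x. frechet_derivative f (at x) v)"
  using assms by (simp_all add: has_derivative_frechet)

lemma ndiff_on_const: "ndiff_on k S (\<lambda>x. c)"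
  by (induction k arbitrary: c) auto

lemma ndiff_on_bounded_linear:
  assumes "bounded_linear L" "ndiff_on k S f" "open S"
  shows "ndiff_on k S (\<lambda>x. L (f x))"
  using assms(2)
proof (induction k arbitrary: f)
  case (Suc k)
  note D = ndiff_on_SucD[OF Suc.prems]
  show ?case
    by (rule ndiff_on_SucI[OF assms(3) bounded_linear.has_derivative[OF assms(1) D(1)] Suc.IH[OF D(2)]])
qed simp

lemma ndiff_on_id: "open S \<Longrightarrow> ndiff_on k S (\<lambda>x. x)"
proof (cases k)
  case (Suc k')
  assume "open S"
  then have "ndiff_on (Suc k') S (\<lambda>x. x)"
    by (rule ndiff_on_SucI[OF _ has_derivative_ident ndiff_on_const])
  then show ?thesis
    unfolding Suc .
qed simp

lemma ndiff_on_add: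
  assumes "ndiff_on k S f" "ndiff_on k S g" "open S"
  shows "ndiff_on k S (\<lambda>x. f x + g x)"
  using assms(1,2)
proof (induction k arbitrary: f g)
  case (Suc k)
  note f = ndiff_on_SucD[OF Suc.prems(1)] and g = ndiff_on_SucD[OF Suc.prems(2)]
  show ?case
    by (rule ndiff_on_SucI[OF assms(3) has_derivative_add[OF f(1) g(1)] Suc.IH[OF f(2) g(2)]])
qed simp

lemma ndiff_on_bilinear:
  assumes "bounded_bilinear B" "ndiff_on k S f" "ndiff_on k S g" "open S"
  shows "ndiff_on k S (\<lambda>x. B (f x) (g x))"
  using assms(2,3)
proof (induction k arbitrary: f g)
  case (Suc k)
  note f = ndiff_on_SucD[OF Suc.prems(1)] ndiff_on_mono[OF Suc.prems(1)]
    and g = ndiff_on_SucD[OF Suc.prems(2)] ndiff_on_mono[OF Suc.prems(2)]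
  show ?case
    by (rule ndiff_on_SucI[OF assms(4) bounded_bilinear.FDERIV[OF assms(1) f(1) g(1)]
          ndiff_on_add[OF Suc.IH[OF f(3) g(2)] Suc.IH[OF f(2) g(3)] assms(4)]])
qed simp

lemma ndiff_on_sum:
  assumes "\<And>i. i \<in> I \<Longrightarrow> ndiff_on k S (f i)" "open S"
  shows "ndiff_on k S (\<lambda>x. \<Sum>i\<in>I. f i x)"
  using assms(1)
  by (induction I rule: infinite_finite_induct)
    (auto intro: ndiff_on_const ndiff_on_add assms(2))

lemma ndiff_on_prod:
  fixes f :: "'i \<Rightarrow> 'e::real_normed_vector \<Rightarrow> real"
  assumes "\<And>i. i \<in> I \<Longrightarrow> ndiff_on k S (f i)" "open S"
  shows "ndiff_on k S (\<lambda>x. \<Prod>i\<in>I. f i x)"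
  using assms(1)
  by (induction I rule: infinite_finite_induct)
    (auto intro: ndiff_on_const ndiff_on_bilinear[OF bounded_bilinear_mult] assms(2))

lemma ndiff_on_inverse:
  fixes f :: "'e::real_normed_vector \<Rightarrow> real"
  assumes "ndiff_on k S f" "open S" "\<And>x. x \<in> S \<Longrightarrow> f x \<noteq> 0"
  shows "ndiff_on k S (\<lambda>x. inverse (f x))"
  using assms(1)
proof (induction k)
  case (Suc k)
  note IH = Suc.IH[OF ndiff_on_mono[OF Suc.prems]] and f = ndiff_on_SucD[OF Suc.prems]
  show ?case
  proof (rule ndiff_on_SucI[OF assms(2)])
    show "((\<lambda>x. inverse (f x)) has_derivative
        (\<lambda>v. - (inverse (f x) * frechet_derivative f (at x) v * inverse (f x)))) (at x)"
      if "x \<in> S" for x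
      using that by (intro Deriv.has_derivative_inverse f(1) assms(3))
    show "ndiff_on k S (\<lambda>x. - (inverse (f x) * frechet_derivative f (at x) v * inverse (f x)))" for v
      by (rule ndiff_on_bounded_linear[OF bounded_linear_minus[OF bounded_linear_ident]
          ndiff_on_bilinear[OF bounded_bilinear_mult
            ndiff_on_bilinear[OF bounded_bilinear_mult IH f(2)] IH]]) (rule assms(2))+
  qed
qed simp

lemma linear_Basis_expansion:
  fixes f :: "'a::euclidean_space \<Rightarrow> 'b::real_vector"
  assumes "linear f"
  shows "f x = (\<Sum>b\<in>Basis. (x \<bullet> b) *\<^sub>R f b)"
proof -
  have "f x = f (\<Sum>b\<in>Basis. (x \<bullet> b) *\<^sub>R b)"
    by (simp add: euclidean_representation)
  also have "\<dots> = (\<Sum>b\<in>Basis. (x \<bullet> b) *\<^sub>R f b)"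
    using assms by (simp add: linear_sum linear_scale)
  finally show ?thesis .
qed

text \<open>
  The derivative of \<open>g \<circ> f\<close> applies \<open>g'(f x)\<close> to a vector that depends on \<open>x\<close>. Expanding this vector
  in a basis leaves only derivatives of \<open>g\<close> in fixed directions, to which the induction hypothesis
  applies.
\<close>

lemma ndiff_on_compose:
  fixes f :: "'e::real_normed_vector \<Rightarrow> 'f::euclidean_space"
  assumes "ndiff_on k S f" "ndiff_on k T g" "open S" "open T" "f ` S \<subseteq> T"
  shows "ndiff_on k S (\<lambda>x. g (f x))"
  using assms(1,2)
proof (induction k arbitrary: g)
  case (Suc k)
  note f = ndiff_on_SucD[OF Suc.prems(1)] and g = ndiff_on_SucD[OF Suc.prems(2)]
  show ?case
  proof (rule ndiff_on_SucI[OF assms(3)])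
    fix x assume x: "x \<in> S"
    have g': "(g has_derivative frechet_derivative g (at (f x))) (at (f x))"
      using x assms(5) by (intro g(1)) auto
    have "((\<lambda>x. g (f x)) has_derivative
        (\<lambda>v. frechet_derivative g (at (f x)) (frechet_derivative f (at x) v))) (at x)"
      by (rule has_derivative_compose[OF f(1)[OF x] g'])
    then show "((\<lambda>x. g (f x)) has_derivative
       (\<lambda>v. \<Sum>b\<in>Basis. (frechet_derivative f (at x) v \<bullet> b) *\<^sub>R frechet_derivative g (at (f x)) b)) (at x)"
      by (simp only: linear_Basis_expansion[OF has_derivative_linear[OF g'],
            of "frechet_derivative f (at x) _"])
  next
    show "ndiff_on k S (\<lambda>x. \<Sum>b\<in>Basis.
        (frechet_derivative f (at x) v \<bullet> b) *\<^sub>R frechet_derivative g (at (f x)) b)" for v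
      by (intro ndiff_on_sum assms(3) ndiff_on_bilinear[OF bounded_bilinear_scaleR
            ndiff_on_bounded_linear[OF bounded_linear_inner_left f(2)]
            Suc.IH[OF ndiff_on_mono[OF Suc.prems(1)] g(2)]])
  qed
qed simp

lemma ndiff_on_vec:
  fixes f :: "'e::real_normed_vector \<Rightarrow> real ^ 'n::finite"
  assumes "\<And>i. ndiff_on k S (\<lambda>x. f x $ i)" "open S"
  shows "ndiff_on k S f"
proof -
  have "f = (\<lambda>x. \<Sum>i\<in>UNIV. (f x $ i) *\<^sub>R axis i 1)"
    by (rule ext, subst basis_expansion[symmetric]) (simp only: scalar_mult_eq_scaleR)
  moreover have "ndiff_on k S (\<lambda>x. \<Sum>i\<in>UNIV. (f x $ i) *\<^sub>R (axis i 1 :: real ^ 'n))"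
    by (intro ndiff_on_sum
        ndiff_on_bilinear[OF bounded_bilinear_scaleR assms(1) ndiff_on_const] assms(2))
  ultimately show ?thesis by simp
qed

text \<open>The determinant is a polynomial in the entries.\<close>

lemma ndiff_on_det:
  fixes G :: "'e::real_normed_vector \<Rightarrow> real ^ 'n::finite ^ 'n"
  assumes "\<And>i j. ndiff_on k S (\<lambda>x. G x $ i $ j)" "open S"
  shows "ndiff_on k S (\<lambda>x. det (G x))"
  unfolding det_def
  by (intro ndiff_on_sum ndiff_on_bilinear[OF bounded_bilinear_mult ndiff_on_const ndiff_on_prod] assms)

section \<open>Smoothness of continuous lifts through immersions\<close>

text \<open>
  A left inverse \<open>l\<close> of \<open>f'\<close> turns \<open>f \<circ> r = g\<close> into \<open>h \<circ> r = k\<close>, where \<open>h = l \<circ> f\<close> has the identity as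
  derivative at \<open>r x\<close>. As \<open>r\<close> is continuous, \<open>r y - r x\<close> is then \<open>k y - k x\<close> up to an error that is small
  relative to \<open>r y - r x\<close> itself. This bounds \<open>r y - r x\<close> by a multiple of \<open>y - x\<close>, and the error becomes
  small relative to \<open>y - x\<close>; the derivative of \<open>k\<close> is thus a derivative of \<open>r\<close>.
\<close>

lemma differentiable_lift:
  fixes f :: "'f::euclidean_space \<Rightarrow> 'g::euclidean_space" and r :: "'e::real_normed_vector \<Rightarrow> 'f"
  assumes f: "(f has_derivative f') (at (r x))" and "inj f'"
    and g: "(g has_derivative g') (at x)"
    and r: "isCont r x" and fr: "\<forall>\<^sub>F y in nhds x. f (r y) = g y"
  shows "r differentiable at x"
proof -
  obtain l where l: "linear l" "l \<circ> f' = id"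
    using linear_injective_left_inverse has_derivative_linear[OF f] \<open>inj f'\<close> by blast
  then have bl: "bounded_linear l"
    by (simp add: linear_conv_bounded_linear)
  define h k k' where "h = (\<lambda>z. l (f z))" and "k = (\<lambda>y. l (g y))" and "k' = (\<lambda>v. l (g' v))"
  have h: "(h has_derivative id) (at (r x))"
    using bounded_linear.has_derivative[OF bl f] l(2) by (simp add: h_def o_def)
  have k: "(k has_derivative k') (at x)"
    unfolding k_def k'_def by (rule bounded_linear.has_derivative[OF bl g])
  have hr: "\<forall>\<^sub>F y in at x. h (r y) = k y" and hrx: "h (r x) = k x"
    using fr eventually_nhds_x_imp_x[OF fr]
    by (auto simp: h_def k_def eventually_at_filter elim: eventually_mono)
  obtain C where C: "C > 0" "\<And>v. norm (k' v) \<le> norm v * C"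
    using bounded_linear.pos_bounded[OF has_derivative_bounded_linear[OF k]] by blast
  have "(r has_derivative k') (at x)"
    unfolding has_derivative_within_alt2
  proof (intro conjI allI impI)
    show "bounded_linear k'"
      using k by (rule has_derivative_bounded_linear)
  next
    fix e :: real assume "e > 0"
    \<comment> \<open>With error \<open>d \<le> 1/2\<close>, the error in \<open>R = norm (r y - r x)\<close> can be absorbed to the left, which
      gives \<open>R \<le> (1 + 2 * C) * norm (y - x)\<close>; the total error
      \<open>d * (1 + (1 + 2 * C)) * norm (y - x)\<close> is then at most \<open>e * norm (y - x)\<close>.\<close>
    define d where "d = min (1/2) (e / (2 + 2 * C))"
    have d: "d > 0" "d \<le> 1/2" and "d \<le> e / (2 + 2 * C)"
      using \<open>e > 0\<close> C(1) by (simp_all only: d_def min.cobounded1 min.cobounded2) simp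
    then have d': "d * (2 + 2 * C) \<le> e"
      using C(1) by (simp add: pos_le_divide_eq)
    have "\<forall>\<^sub>F z in nhds (r x). norm (h z - h (r x) - (z - r x)) \<le> d * norm (z - r x)"
      using h d(1) unfolding has_derivative_within_alt2 eventually_at_filter
      by (auto elim!: eventually_mono allE[of _ d])
    then have 1: "\<forall>\<^sub>F y in at x. norm (h (r y) - h (r x) - (r y - r x)) \<le> d * norm (r y - r x)"
      using r unfolding isCont_def by (rule eventually_compose_filterlim)
    have 2: "\<forall>\<^sub>F y in at x. norm (k y - k x - k' (y - x)) \<le> d * norm (y - x)"
      using k d(1) unfolding has_derivative_within_alt2 by auto
    show "\<forall>\<^sub>F y in at x. norm (r y - r x - k' (y - x)) \<le> e * norm (y - x)"
      using 1 2 hr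
    proof eventually_elim
      case (elim y)
      define R N where "R = norm (r y - r x)" and "N = norm (y - x)"
      have a: "norm (k y - k x - (r y - r x)) \<le> d * R"
        using elim(1,3) hrx by (simp add: R_def)
      have b: "norm (k y - k x - k' (y - x)) \<le> d * N"
        using elim(2) by (simp add: N_def)
      have "norm (k y - k x) \<le> norm (k y - k x - k' (y - x)) + norm (k' (y - x))"
        by (metis diff_add_cancel norm_triangle_ineq)
      then have c: "norm (k y - k x) \<le> (d + C) * N"
        using b C(2)[of "y - x"] by (simp add: N_def algebra_simps)
      have "R \<le> norm (k y - k x) + norm (k y - k x - (r y - r x))"
        unfolding R_def by (metis norm_triangle_sub norm_minus_commute)
      also have "\<dots> \<le> (d + C) * N + (1/2) * R"
        using a c d(2) mult_right_mono[OF d(2), of R] by (simp add: R_def)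
      finally have "R \<le> 2 * (d + C) * N" by (simp add: algebra_simps)
      also have "\<dots> \<le> (1 + 2 * C) * N"
        using d(2) by (intro mult_right_mono) (auto simp: N_def)
      finally have R: "R \<le> (1 + 2 * C) * N" .
      have "norm (r y - r x - k' (y - x)) =
          norm ((k y - k x - k' (y - x)) - (k y - k x - (r y - r x)))"
        by (simp add: algebra_simps)
      also have "\<dots> \<le> d * N + d * R"
        using norm_triangle_ineq4 a b by (smt (verit))
      also have "\<dots> \<le> d * N + d * ((1 + 2 * C) * N)"
        using R d(1) by simp
      also have "\<dots> \<le> (d * (2 + 2 * C)) * N"
        using d(1) by (simp add: algebra_simps N_def)
      also have "\<dots> \<le> e * N"
        using d' by (intro mult_right_mono) (auto simp: N_def)
      finally show ?case by (simp add: N_def)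
    qed
  qed
  then show ?thesis
    by (auto simp: differentiable_def)
qed

text \<open>
  The Gram matrix of the columns of an injective linear map \<open>F\<close> is invertible, since \<open>w \<bullet> G w\<close> is the
  square of the norm of \<open>F w\<close>. Cramer's rule for the normal equations recovers \<open>u\<close> from
  \<open>F u\<close> by a formula that is rational in \<open>F\<close> and \<open>F u\<close>.
\<close>

lemma gram_matrix_solve:
  fixes F :: "real ^ 'n \<Rightarrow> 'g::real_inner" and u :: "real ^ 'n"
  assumes "linear F" "inj F"
  defines "G \<equiv> (\<chi> i j. F (axis i 1) \<bullet> F (axis j 1)) :: real ^ 'n ^ 'n"
  shows "det G \<noteq> 0"
    and "u = (\<chi> k. det (\<chi> i j. if j = k then F (axis i 1) \<bullet> F u else G $ i $ j) / det G)"
proof -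
  have F: "F w = (\<Sum>j\<in>UNIV. (w $ j) *\<^sub>R F (axis j 1))" for w
  proof -
    have "F w = F (\<Sum>j\<in>UNIV. (w $ j) *\<^sub>R axis j 1)"
      using basis_expansion[of w] by (simp add: scalar_mult_eq_scaleR)
    then show ?thesis
      using assms by (simp add: linear_sum linear_scale)
  qed
  have G: "G *v w = (\<chi> i. F (axis i 1) \<bullet> F w)" for w
    by (subst F[of w])
      (simp add: G_def matrix_vector_mult_def vec_eq_iff inner_sum_right mult.commute)
  have "w = 0" if "G *v w = 0" for w
  proof -
    have "F w \<bullet> F w = (\<Sum>i\<in>UNIV. w $ i * (F (axis i 1) \<bullet> F w))"
      by (subst F[of w]) (simp add: inner_sum_left)
    also have "\<dots> = 0"
      using that unfolding G by (simp add: vec_eq_iff)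
    finally have "F w = F 0"
      using assms by (simp add: linear_0)
    then show ?thesis
      using assms by (simp add: inj_eq)
  qed
  then show "det G \<noteq> 0"
    by (metis invertible_det_nz invertible_left_inverse matrix_left_invertible_ker)
  from cramer[OF this, of u "\<chi> i. F (axis i 1) \<bullet> F u"]
  show "u = (\<chi> k. det (\<chi> i j. if j = k then F (axis i 1) \<bullet> F u else G $ i $ j) / det G)"
    by (simp add: G cong: if_cong)
qed

text \<open>
  Bootstrapping: by \<open>gram_matrix_solve\<close> the derivative of \<open>r\<close> is a rational expression in \<open>f' \<circ> r\<close> and \<open>g'\<close>,
  so if \<open>r\<close> is \<open>k\<close> times differentiable, then so is its derivative.
\<close>

lemma smooth_on_lift:
  fixes f :: "real ^ 'n::finite \<Rightarrow> 'g::euclidean_space" and r :: "'e::real_normed_vector \<Rightarrow> real ^ 'n"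
  assumes "open S" "open T" "continuous_on S r" "r ` S \<subseteq> T"
    and f: "smooth_on T f" and imm: "\<And>z. z \<in> T \<Longrightarrow> inj (frechet_derivative f (at z))"
    and g: "smooth_on S g" and fr: "\<And>x. x \<in> S \<Longrightarrow> f (r x) = g x"
  shows "smooth_on S r"
proof -
  define F where "F = (\<lambda>x. frechet_derivative f (at (r x)))"
  define G where "G = (\<lambda>x. (\<chi> i j. F x (axis i 1) \<bullet> F x (axis j 1)) :: real ^ 'n ^ 'n)"
  define r' where "r' = (\<lambda>x v. (\<chi> k. det (\<chi> i j. if j = k
     then F x (axis i 1) \<bullet> frechet_derivative g (at x) v else G x $ i $ j) / det (G x)) :: real ^ 'n)"
  have derF: "(f has_derivative F x) (at (r x))" if "x \<in> S" for x
    unfolding F_def using that assms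
    by (intro has_derivative_frechet smooth_on_imp_differentiable[OF f]) auto
  have F: "linear (F x)" "inj (F x)" if "x \<in> S" for x
    using has_derivative_linear[OF derF[OF that]] imm[of "r x"] that assms(4) by (auto simp: F_def)
  have derg: "(g has_derivative frechet_derivative g (at x)) (at x)" if "x \<in> S" for x
    using that by (intro has_derivative_frechet smooth_on_imp_differentiable[OF g])
  have r': "(r has_derivative r' x) (at x)" if x: "x \<in> S" for x
  proof -
    have "isCont r x"
      using assms(1,3) x by (simp add: continuous_on_eq_continuous_at)
    moreover have "\<forall>\<^sub>F y in nhds x. f (r y) = g y"
      using eventually_nhds_in_open[OF assms(1) x] by eventually_elim (rule fr)
    ultimately have "r differentiable at x"
      by (rule differentiable_lift[where x=x and r=r and f=f, OF derF[OF x] F(2)[OF x] derg[OF x]])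
    then have r: "(r has_derivative frechet_derivative r (at x)) (at x)"
      by (rule has_derivative_frechet)
    then have "((\<lambda>x. f (r x)) has_derivative (\<lambda>v. F x (frechet_derivative r (at x) v))) (at x)"
      using derF[OF x] by (rule has_derivative_compose)
    then have "(g has_derivative (\<lambda>v. F x (frechet_derivative r (at x) v))) (at x)"
      using fr by (rule has_derivative_transform_within_open[OF _ assms(1) x])
    then have "frechet_derivative g (at x) v = F x (frechet_derivative r (at x) v)" for v
      using derg[OF x] by (metis has_derivative_unique)
    then have "frechet_derivative r (at x) v = r' x v" for v
      unfolding r'_def G_def by (simp only: gram_matrix_solve(2)[OF F[OF x], symmetric])
    then have "frechet_derivative r (at x) = r' x" ..
    then show ?thesis
      using r by simp
  qed
  have "ndiff_on k S r" for k
  proof (induction k)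
    case (Suc k)
    have F': "ndiff_on k S (\<lambda>x. F x v)" for v
      unfolding F_def
      by (rule ndiff_on_compose[OF Suc ndiff_on_SucD(2) assms(1,2,4)])
        (use f in \<open>simp only: smooth_on_iff_ndiff_on\<close>)
    have G': "ndiff_on k S (\<lambda>x. G x $ i $ j)" for i j
      unfolding G_def using ndiff_on_bilinear[OF bounded_bilinear_inner F' F' assms(1)] by simp
    have g': "ndiff_on k S (\<lambda>x. frechet_derivative g (at x) v)" for v
      by (rule ndiff_on_SucD(2)) (use g in \<open>simp only: smooth_on_iff_ndiff_on\<close>)
    have C': "ndiff_on k S (\<lambda>x. (\<chi> i j. if j = l then F x (axis i 1) \<bullet> frechet_derivative g (at x) v
        else G x $ i $ j) $ i $ j)" for v l i j
      by (cases "j = l")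
        (simp_all add: ndiff_on_bilinear[OF bounded_bilinear_inner F' g' assms(1)] G')
    have "det (G x) \<noteq> 0" if "x \<in> S" for x
      unfolding G_def using gram_matrix_solve(1)[OF F[OF that]] .
    then have I: "ndiff_on k S (\<lambda>x. inverse (det (G x)))"
      by (rule ndiff_on_inverse[OF ndiff_on_det[OF G' assms(1)] assms(1)])
    have "ndiff_on k S (\<lambda>x. r' x v $ l)" for v l
      unfolding r'_def divide_inverse vec_lambda_beta[of _ l]
      by (rule ndiff_on_bilinear[OF bounded_bilinear_mult ndiff_on_det[OF C' assms(1)] I assms(1)])
    then have "ndiff_on k S (\<lambda>x. r' x v)" for v
      by (rule ndiff_on_vec[OF _ assms(1)])
    with assms(1) r' show ?case
      by (rule ndiff_on_SucI)
  qed simp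
  then show ?thesis
    by (simp add: smooth_on_iff_ndiff_on)
qed

section \<open>Smooth maps in charts\<close>

lemma smooth_on_subset: "smooth_on S f \<Longrightarrow> S' \<subseteq> S \<Longrightarrow> smooth_on S' f"
  unfolding smooth_on_def by blast

lemma smooth_on_deriv: "smooth_on S f \<Longrightarrow> smooth_on S (\<lambda>x. frechet_derivative f (at x) v)"
  unfolding smooth_on_def by (metis iter_deriv.simps(2))

lemma smooth_on_local: "(\<And>x. x \<in> S \<Longrightarrow> \<exists>S'. x \<in> S' \<and> smooth_on S' f) \<Longrightarrow> smooth_on S f"
  unfolding smooth_on_def by blast

lemma smooth_on_cong: "open S \<Longrightarrow> (\<And>x. x \<in> S \<Longrightarrow> f x = g x) \<Longrightarrow> smooth_on S f \<Longrightarrow> smooth_on S g"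
  unfolding smooth_on_iff_ndiff_on by (blast intro: ndiff_on_cong)

lemma smooth_on_compose:
  fixes f :: "'e::real_normed_vector \<Rightarrow> 'f::euclidean_space"
  assumes "smooth_on S f" "smooth_on T g" "open S" "open T" "f ` S \<subseteq> T"
  shows "smooth_on S (\<lambda>x. g (f x))"
  using assms unfolding smooth_on_iff_ndiff_on by (blast intro: ndiff_on_compose)

lemma smooth_on_id: "smooth_on UNIV id"
  by (simp add: smooth_on_iff_ndiff_on id_def ndiff_on_id)

lemma
  assumes "is_chart M (U, x)"
  shows openin_chart_dom: "openin M U"
    and inj_on_chart: "inj_on x U"
    and open_chart_image: "openin M W \<Longrightarrow> open (x ` (U \<inter> W))"
    and openin_chart_preimage: "open B \<Longrightarrow> openin M {p \<in> U. x p \<in> B}"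
proof -
  have U: "openin M U" and o: "open (x ` U)"
    and h: "homeomorphic_map (subtopology M U) (top_of_set (x ` U)) x"
    using assms by (auto simp: is_chart_def)
  have top: "topspace (subtopology M U) = U"
    using openin_subset[OF U] by auto
  show "openin M U" by fact
  show "inj_on x U"
    using homeomorphic_imp_injective_map[OF h] unfolding top .
  show "open (x ` (U \<inter> W))" if "openin M W"
  proof -
    have "openin (subtopology M U) (U \<inter> W)"
      using that unfolding openin_subtopology by blast
    then have "openin (top_of_set (x ` U)) (x ` (U \<inter> W))"
      using homeomorphic_imp_open_map[OF h] by (simp add: open_map_def)
    then show ?thesis
      using o by (rule openin_open_trans)
  qed
  show "openin M {p \<in> U. x p \<in> B}" if "open B"
  proof -
    have "continuous_map (subtopology M U) (top_of_set (x ` U)) x"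
      using h by (rule homeomorphic_imp_continuous_map)
    then have "continuous_map (subtopology M U) euclidean x"
      by (simp add: continuous_map_in_subtopology)
    then have "openin (subtopology M U) {p \<in> topspace (subtopology M U). x p \<in> B}"
      using that by (intro openin_continuous_map_preimage) auto
    then show ?thesis
      using openin_trans_full[OF _ U] unfolding top by blast
  qed
qed

lemma smooth_atlas_chart: "smooth_atlas M A \<Longrightarrow> (U, x) \<in> A \<Longrightarrow> is_chart M (U, x)"
  by (simp add: smooth_atlas_def)

lemma smooth_atlas_covers:
  assumes "smooth_atlas M A" "p \<in> topspace M"
  obtains U x where "(U, x) \<in> A" "p \<in> U"
  using assms unfolding smooth_atlas_def by (metis UN_E prod.collapse)

lemma chart_dom_subset: "is_chart M (U, x) \<Longrightarrow> U \<subseteq> topspace M"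
  by (rule openin_subset[OF openin_chart_dom])

lemma inv_into_chart: "is_chart M (U, x) \<Longrightarrow> p \<in> U \<Longrightarrow> inv_into U x (x p) = p"
  by (simp add: inj_on_chart)

lemma smooth_mapD:
  assumes "smooth_map M A N B f"
  shows "continuous_map M N f"
    and "(U, x) \<in> A \<Longrightarrow> (W, y) \<in> B \<Longrightarrow> smooth_on (x ` (U \<inter> f -` W)) (y \<circ> f \<circ> inv_into U x)"
  using assms unfolding smooth_map_def by auto

lemma smooth_mapI:
  assumes "continuous_map M N f"
    and "\<And>U x W y. (U, x) \<in> A \<Longrightarrow> (W, y) \<in> B \<Longrightarrow>
      smooth_on (x ` (U \<inter> f -` W)) (y \<circ> f \<circ> inv_into U x)"
  shows "smooth_map M A N B f"
  using assms unfolding smooth_map_def by auto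

lemma open_chart_preimage:
  assumes "is_chart M (U, x)" "continuous_map M N f" "openin N W"
  shows "open (x ` (U \<inter> f -` W))"
proof -
  have "openin M {p \<in> topspace M. f p \<in> W}"
    using assms(2,3) by (rule openin_continuous_map_preimage)
  then have "open (x ` (U \<inter> {p \<in> topspace M. f p \<in> W}))"
    by (rule open_chart_image[OF assms(1)])
  moreover have "U \<inter> {p \<in> topspace M. f p \<in> W} = U \<inter> f -` W"
    using chart_dom_subset[OF assms(1)] by auto
  ultimately show ?thesis by simp
qed

text \<open>Embeddings and diffeomorphisms have the value \<open>undefined\<close> outside the carrier, while composites
  and inverses that are smooth by construction have arbitrary values there. The following lemma passes
  from the latter to the former.\<close>

lemma smooth_map_cong:
  assumes A: "smooth_atlas M A" and B: "smooth_atlas N B"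
    and f: "smooth_map M A N B f" and fg: "\<And>p. p \<in> topspace M \<Longrightarrow> f p = g p"
  shows "smooth_map M A N B g"
proof (rule smooth_mapI)
  show "continuous_map M N g"
    using smooth_mapD(1)[OF f] fg by (rule continuous_map_eq)
next
  fix U x W y assume c: "(U, x) \<in> A" "(W, y) \<in> B"
  note U = chart_dom_subset[OF smooth_atlas_chart[OF A c(1)]]
  then have eq: "U \<inter> f -` W = U \<inter> g -` W"
    using fg by auto
  have "smooth_on (x ` (U \<inter> f -` W)) (y \<circ> g \<circ> inv_into U x)"
  proof (rule smooth_on_cong[where f="y \<circ> f \<circ> inv_into U x"])
    show "open (x ` (U \<inter> f -` W))"
      by (rule open_chart_preimage[OF smooth_atlas_chart[OF A c(1)] smooth_mapD(1)[OF f]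
            openin_chart_dom[OF smooth_atlas_chart[OF B c(2)]]])
    show "(y \<circ> f \<circ> inv_into U x) s = (y \<circ> g \<circ> inv_into U x) s" if "s \<in> x ` (U \<inter> f -` W)" for s
      using that fg U by (auto simp: inv_into_into subset_iff)
  qed (rule smooth_mapD(2)[OF f c])
  then show "smooth_on (x ` (U \<inter> g -` W)) (y \<circ> g \<circ> inv_into U x)"
    by (simp add: eq)
qed

text \<open>Given charts of \<open>M\<close> and of \<open>P\<close>, smoothness of \<open>g \<circ> f\<close> can only be seen locally, near each point in a
  chart of \<open>N\<close> around its image.\<close>

lemma smooth_map_compose:
  assumes A: "smooth_atlas M A" and B: "smooth_atlas N B" and C: "smooth_atlas P C"
    and f: "smooth_map M A N B f" and g: "smooth_map N B P C g"
  shows "smooth_map M A P C (g \<circ> f)"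
proof (rule smooth_mapI)
  show "continuous_map M P (g \<circ> f)"
    using smooth_mapD(1)[OF f] smooth_mapD(1)[OF g] by (rule continuous_map_compose)
next
  fix U x Z z assume c: "(U, x) \<in> A" "(Z, z) \<in> C"
  note cU = smooth_atlas_chart[OF A c(1)] and cZ = smooth_atlas_chart[OF C c(2)]
  show "smooth_on (x ` (U \<inter> (g \<circ> f) -` Z)) (z \<circ> (g \<circ> f) \<circ> inv_into U x)"
  proof (rule smooth_on_local)
    fix s assume "s \<in> x ` (U \<inter> (g \<circ> f) -` Z)"
    then obtain p where p: "p \<in> U" "g (f p) \<in> Z" "s = x p" by auto
    have "p \<in> topspace M"
      using p(1) chart_dom_subset[OF cU] by auto
    then have "f p \<in> topspace N"
      using smooth_mapD(1)[OF f] by (auto simp: continuous_map_def)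
    then obtain W y where d: "(W, y) \<in> B" "f p \<in> W"
      by (rule smooth_atlas_covers[OF B])
    note cW = smooth_atlas_chart[OF B d(1)]
    define Q where "Q = {q \<in> topspace N. g q \<in> Z} \<inter> W"
    have Q: "openin N Q" "Q \<subseteq> W" "\<And>q. q \<in> Q \<Longrightarrow> g q \<in> Z" "f p \<in> Q"
      using openin_chart_dom[OF cW] \<open>f p \<in> topspace N\<close> p d
        openin_continuous_map_preimage[OF smooth_mapD(1)[OF g] openin_chart_dom[OF cZ]]
      unfolding Q_def by auto
    define S where "S = x ` (U \<inter> f -` Q)"
    have S: "open S"
      unfolding S_def by (rule open_chart_preimage[OF cU smooth_mapD(1)[OF f] Q(1)])
    note yi = inv_into_chart[OF cW]
    note xi = inv_into_chart[OF cU]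
    have "smooth_on S (\<lambda>s. (z \<circ> g \<circ> inv_into W y) ((y \<circ> f \<circ> inv_into U x) s))"
    proof (rule smooth_on_compose[where f="y \<circ> f \<circ> inv_into U x" and g="z \<circ> g \<circ> inv_into W y"])
      show "smooth_on S (y \<circ> f \<circ> inv_into U x)"
        by (rule smooth_on_subset[OF smooth_mapD(2)[OF f c(1) d(1)]])
          (use Q(2) in \<open>auto simp: S_def\<close>)
      show "smooth_on (y ` (W \<inter> g -` Z)) (z \<circ> g \<circ> inv_into W y)"
        by (rule smooth_mapD(2)[OF g d(1) c(2)])
      show "open (y ` (W \<inter> g -` Z))"
        by (rule open_chart_preimage[OF cW smooth_mapD(1)[OF g] openin_chart_dom[OF cZ]])
      show "(y \<circ> f \<circ> inv_into U x) ` S \<subseteq> y ` (W \<inter> g -` Z)"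
        using Q(2,3) xi by (auto simp: S_def)
    qed (rule S)
    then have "smooth_on S (z \<circ> (g \<circ> f) \<circ> inv_into U x)"
      by (rule smooth_on_cong[OF S, rotated]) (use xi yi Q(2) in \<open>auto simp: S_def\<close>)
    moreover have "s \<in> S"
      using p Q(4) by (auto simp: S_def)
    ultimately show "\<exists>S. s \<in> S \<and> smooth_on S (z \<circ> (g \<circ> f) \<circ> inv_into U x)"
      by blast
  qed
qed

lemma smooth_atlas_eucl: "smooth_atlas euclidean eucl_atlas"
  by (simp add: smooth_atlas_def eucl_atlas_def is_chart_def transition_def transition_dom_def
      smooth_on_id homeomorphic_map_id inv_id)

lemma smooth_map_eucl_iff:
  "smooth_map M A euclidean eucl_atlas f \<longleftrightarrow> continuous_map M euclidean f \<and>
     (\<forall>(U, x)\<in>A. smooth_on (x ` U) (f \<circ> inv_into U x))"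
  by (simp add: smooth_map_def eucl_atlas_def)

text \<open>The global form of \<open>smooth_on_lift\<close>: compactness makes \<open>\<phi>\<close> a closed map, which gives continuity of
  the lift; in charts the lift is then a continuous lift through an immersion.\<close>

lemma smooth_map_lift:
  fixes \<phi> :: "'b \<Rightarrow> real ^ 'm::finite" and \<psi> :: "'a \<Rightarrow> real ^ 'm"
  assumes A: "smooth_atlas M A" and B: "smooth_atlas N B" and "compact_space N"
    and \<phi>: "smooth_map N B euclidean eucl_atlas \<phi>" "immersion B \<phi>" "inj_on \<phi> (topspace N)"
    and \<psi>: "smooth_map M A euclidean eucl_atlas \<psi>"
    and sub: "\<psi> ` topspace M \<subseteq> \<phi> ` topspace N"
  shows "smooth_map M A N B (inv_into (topspace N) \<phi> \<circ> \<psi>)" (is "smooth_map _ _ _ _ ?\<rho>")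
proof (rule smooth_mapI)
  have \<rho>: "?\<rho> p \<in> topspace N" "\<phi> (?\<rho> p) = \<psi> p" if "p \<in> topspace M" for p
    using that sub by (auto simp: inv_into_into f_inv_into_f image_subset_iff)
  show cont: "continuous_map M N ?\<rho>"
    unfolding continuous_map_closedin
  proof (intro conjI ballI allI impI)
    fix C assume C: "closedin N C"
    have "closed_map N euclidean \<phi>"
      using smooth_mapD(1)[OF \<phi>(1)] \<open>compact_space N\<close> by (rule continuous_imp_closed_map) simp
    then have "closedin euclidean (\<phi> ` C)"
      using C by (simp add: closed_map_def)
    then have "closedin M {p \<in> topspace M. \<psi> p \<in> \<phi> ` C}"
      using smooth_mapD(1)[OF \<psi>] by (rule closedin_continuous_map_preimage[rotated])
    moreover have "\<psi> p \<in> \<phi> ` C \<longleftrightarrow> ?\<rho> p \<in> C" if "p \<in> topspace M" for p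
      using \<rho>[OF that] inj_on_image_mem_iff[OF \<phi>(3) _ closedin_subset[OF C]] by metis
    ultimately show "closedin M {p \<in> topspace M. ?\<rho> p \<in> C}"
      by (metis (mono_tags, lifting) Collect_cong)
  qed (use \<rho> in auto)
  fix U x W y assume c: "(U, x) \<in> A" "(W, y) \<in> B"
  note cU = smooth_atlas_chart[OF A c(1)] and cW = smooth_atlas_chart[OF B c(2)]
  note yi = inv_into_chart[OF cW]
  note xi = inv_into_chart[OF cU]
  note U = chart_dom_subset[OF cU]
  let ?S = "x ` (U \<inter> ?\<rho> -` W)" and ?r = "y \<circ> ?\<rho> \<circ> inv_into U x"
  have S: "open ?S"
    by (rule open_chart_preimage[OF cU cont openin_chart_dom[OF cW]])
  show "smooth_on ?S ?r"
  proof (rule smooth_on_lift[where f="\<phi> \<circ> inv_into W y" and g="\<psi> \<circ> inv_into U x"])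
    show "open (y ` W)"
      using open_chart_image[OF cW openin_chart_dom[OF cW]] by simp
    show "continuous_on ?S ?r"
      unfolding continuous_on_open_vimage[OF S]
    proof (intro allI impI)
      fix V :: "(real ^ 'd) set" assume "open V"
      then have "openin N {q \<in> W. y q \<in> V}"
        by (rule openin_chart_preimage[OF cW])
      then have "open (x ` (U \<inter> ?\<rho> -` {q \<in> W. y q \<in> V}))"
        by (rule open_chart_preimage[OF cU cont])
      moreover have "x ` (U \<inter> ?\<rho> -` {q \<in> W. y q \<in> V}) = ?r -` V \<inter> ?S"
        using xi by auto
      ultimately show "open (?r -` V \<inter> ?S)"
        by simp
    qed
    show "?r ` ?S \<subseteq> y ` W"
      using xi by auto
    show "smooth_on (y ` W) (\<phi> \<circ> inv_into W y)"
      using \<phi>(1) c(2) unfolding smooth_map_eucl_iff by auto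
    show "inj (frechet_derivative (\<phi> \<circ> inv_into W y) (at z))" if "z \<in> y ` W" for z
      using \<phi>(2) c(2) that unfolding immersion_def by auto
    have "smooth_on (x ` U) (\<psi> \<circ> inv_into U x)"
      using \<psi> c(1) unfolding smooth_map_eucl_iff by auto
    then show "smooth_on ?S (\<psi> \<circ> inv_into U x)"
      by (rule smooth_on_subset) auto
    show "(\<phi> \<circ> inv_into W y) (?r s) = (\<psi> \<circ> inv_into U x) s" if "s \<in> ?S" for s
      using that xi yi \<rho>(2) U by auto
  qed (rule S)
qed

section \<open>Embeddings with the same image\<close>

lemma EmbD:
  assumes "\<phi> \<in> Emb M A"
  shows "\<phi> \<in> extensional (topspace M)" "inj_on \<phi> (topspace M)"
    "smooth_map M A euclidean eucl_atlas \<phi>" "immersion A \<phi>"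
  using assms by (auto simp: Emb_def)

lemma DiffD:
  assumes "\<rho> \<in> Diff M A"
  shows "\<rho> \<in> extensional (topspace M)" "bij_betw \<rho> (topspace M) (topspace M)"
    "smooth_map M A M A \<rho>" "smooth_map M A M A (inv_into (topspace M) \<rho>)"
  using assms by (auto simp: Diff_def)

lemma image_compose_Diff:
  assumes "\<rho> \<in> Diff M A"
  shows "compose (topspace M) \<phi> \<rho> ` topspace M = \<phi> ` topspace M"
proof -
  have "compose (topspace M) \<phi> \<rho> ` topspace M = \<phi> ` \<rho> ` topspace M"
    by (simp add: compose_def image_image)
  then show ?thesis
    using bij_betw_imp_surj_on[OF DiffD(2)[OF assms]] by simp
qed

text \<open>The diffeomorphism is \<open>\<phi>\<^sup>-\<^sup>1 \<circ> \<psi>\<close>. Its inverse \<open>\<psi>\<^sup>-\<^sup>1 \<circ> \<phi>\<close> is smooth for the same reason, by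
  exchanging \<open>\<phi>\<close> and \<open>\<psi>\<close>.\<close>

lemma Emb_same_image_Diff:
  fixes \<phi> \<psi> :: "'a \<Rightarrow> real ^ 'm::finite"
  assumes A: "smooth_atlas M A" and "compact_space M"
    and \<phi>: "\<phi> \<in> Emb M A" and \<psi>: "\<psi> \<in> Emb M A"
    and im: "\<phi> ` topspace M = \<psi> ` topspace M"
  obtains \<rho> where "\<rho> \<in> Diff M A" "\<psi> = compose (topspace M) \<phi> \<rho>"
proof
  let ?M = "topspace M"
  define \<rho> where "\<rho> = restrict (inv_into ?M \<phi> \<circ> \<psi>) ?M"
  have \<rho>: "\<rho> p \<in> ?M" "\<phi> (\<rho> p) = \<psi> p" if "p \<in> ?M" for p
    using that im by (auto simp: \<rho>_def inv_into_into f_inv_into_f)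
  have bij\<phi>: "bij_betw (inv_into ?M \<phi>) (\<phi> ` ?M) ?M"
    by (intro bij_betw_inv_into inj_on_imp_bij_betw EmbD(2)[OF \<phi>])
  have bij: "bij_betw \<rho> ?M ?M"
  proof -
    have "bij_betw \<psi> ?M (\<phi> ` ?M)"
      using EmbD(2)[OF \<psi>] im by (simp add: bij_betw_def)
    then have "bij_betw (inv_into ?M \<phi> \<circ> \<psi>) ?M ?M"
      using bij\<phi> by (rule bij_betw_trans)
    then show ?thesis
      by (rule bij_betw_cong[THEN iffD1, rotated]) (simp add: \<rho>_def)
  qed
  have smooth: "smooth_map M A M A (inv_into ?M \<alpha> \<circ> \<beta>)"
    if "\<alpha> \<in> Emb M A" "\<beta> \<in> Emb M A" "\<beta> ` ?M = \<alpha> ` ?M" for \<alpha> \<beta> :: "'a \<Rightarrow> real ^ 'm"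
    using that by (intro smooth_map_lift[OF A A \<open>compact_space M\<close>] EmbD(2-4)) auto
  have inv: "(inv_into ?M \<psi> \<circ> \<phi>) p = inv_into ?M \<rho> p" if "p \<in> ?M" for p
  proof -
    have "p \<in> \<rho> ` ?M"
      using bij_betw_imp_surj_on[OF bij] that by simp
    then obtain q where q: "q \<in> ?M" "p = \<rho> q"
      by blast
    have "inv_into ?M \<psi> (\<phi> p) = q"
      unfolding q(2) \<rho>(2)[OF q(1)] by (rule inv_into_f_f[OF EmbD(2)[OF \<psi>] q(1)])
    moreover have "inv_into ?M \<rho> p = q"
      unfolding q(2) by (rule inv_into_f_f[OF bij_betw_imp_inj_on[OF bij] q(1)])
    ultimately show ?thesis
      by simp
  qed
  show "\<rho> \<in> Diff M A"
    unfolding Diff_def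
  proof (intro CollectI conjI bij)
    show "\<rho> \<in> extensional ?M"
      by (simp add: \<rho>_def)
    show "smooth_map M A M A \<rho>"
      by (rule smooth_map_cong[OF A A smooth[OF \<phi> \<psi> im[symmetric]]]) (simp add: \<rho>_def)
    show "smooth_map M A M A (inv_into ?M \<rho>)"
      by (rule smooth_map_cong[OF A A smooth[OF \<psi> \<phi> im] inv])
  qed
  show "\<psi> = compose ?M \<phi> \<rho>"
    using EmbD(1)[OF \<psi>] \<rho>(2)
    by (intro extensionalityI[of _ ?M]) (simp_all add: compose_eq)
qed

text \<open>With this description, reparametrization is an equivalence relation at a glance, and its classes
  correspond to image sets.\<close>

lemma reparam_iff:
  fixes \<phi> \<psi> :: "'a \<Rightarrow> real ^ 'm::finite"
  assumes "smooth_atlas M A" "compact_space M"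
  shows "(\<phi>, \<psi>) \<in> reparam M A \<longleftrightarrow>
    \<phi> \<in> Emb M A \<and> \<psi> \<in> Emb M A \<and> \<phi> ` topspace M = \<psi> ` topspace M"
proof
  assume "(\<phi>, \<psi>) \<in> reparam M A"
  then obtain \<rho> where "\<phi> \<in> Emb M A" "\<psi> \<in> Emb M A" "\<rho> \<in> Diff M A"
    "\<psi> = compose (topspace M) \<phi> \<rho>"
    by (auto simp: reparam_def)
  then show "\<phi> \<in> Emb M A \<and> \<psi> \<in> Emb M A \<and> \<phi> ` topspace M = \<psi> ` topspace M"
    by (simp add: image_compose_Diff)
next
  assume R: "\<phi> \<in> Emb M A \<and> \<psi> \<in> Emb M A \<and> \<phi> ` topspace M = \<psi> ` topspace M"
  then obtain \<rho> where "\<rho> \<in> Diff M A" "\<psi> = compose (topspace M) \<phi> \<rho>"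
    using Emb_same_image_Diff[OF assms] by metis
  then show "(\<phi>, \<psi>) \<in> reparam M A"
    using R by (auto simp: reparam_def)
qed

text \<open>In charts, \<open>\<rho>\<close> has an injective derivative, because \<open>\<rho>\<^sup>-\<^sup>1\<close> is differentiable and so provides a left
  inverse of it.\<close>

lemma immersion_compose_Diff:
  assumes A: "smooth_atlas M A"
    and \<phi>: "smooth_map M A euclidean eucl_atlas \<phi>" "immersion A \<phi>" and \<rho>: "\<rho> \<in> Diff M A"
  shows "immersion A (compose (topspace M) \<phi> \<rho>)"
  unfolding immersion_def
proof clarify
  fix U x p assume c: "(U, x) \<in> A" and p: "p \<in> U"
  let ?i = "inv_into (topspace M) \<rho>"
  note cU = smooth_atlas_chart[OF A c]
  note U = chart_dom_subset[OF cU]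
  have "\<rho> p \<in> topspace M"
    using DiffD(2)[OF \<rho>] p U by (auto simp: bij_betw_def)
  then obtain W y where d: "(W, y) \<in> A" "\<rho> p \<in> W"
    by (rule smooth_atlas_covers[OF A])
  note cW = smooth_atlas_chart[OF A d(1)]
  note yi = inv_into_chart[OF cW]
  note xi = inv_into_chart[OF cU]
  have \<rho>i: "?i (\<rho> q) = q" if "q \<in> U" for q
    using DiffD(2)[OF \<rho>] that U by (auto simp: bij_betw_def)
  define r s F where "r = y \<circ> \<rho> \<circ> inv_into U x" and "s = x \<circ> ?i \<circ> inv_into W y"
    and "F = \<phi> \<circ> inv_into W y"
  define S where "S = x ` (U \<inter> \<rho> -` W)"
  have S: "open S" "x p \<in> S"
    unfolding S_def using p d(2)
    by (auto intro: open_chart_preimage[OF cU smooth_mapD(1)[OF DiffD(3)[OF \<rho>]] openin_chart_dom[OF cW]])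
  have rp: "r (x p) = y (\<rho> p)"
    using p by (simp add: r_def xi)
  have "r differentiable at (x p)"
    using smooth_on_imp_differentiable[OF smooth_mapD(2)[OF DiffD(3)[OF \<rho>] c d(1)]] S(2)
    by (simp add: r_def S_def)
  then obtain r' where r: "(r has_derivative r') (at (x p))"
    by (auto simp: differentiable_def)
  have "s differentiable at (y (\<rho> p))"
    unfolding s_def
    by (rule smooth_on_imp_differentiable[OF smooth_mapD(2)[OF DiffD(4)[OF \<rho>] d(1) c]])
      (use p d(2) in \<open>auto simp: \<rho>i\<close>)
  then obtain s' where s: "(s has_derivative s') (at (r (x p)))"
    by (auto simp: differentiable_def rp)
  have "((s \<circ> r) has_derivative (s' \<circ> r')) (at (x p))"
    by (rule diff_chain_at[OF r s])
  then have "((\<lambda>z. z) has_derivative (s' \<circ> r')) (at (x p))"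
    by (rule has_derivative_transform_within_open[OF _ S])
      (auto simp: S_def r_def s_def xi yi \<rho>i)
  then have "s' \<circ> r' = (\<lambda>v. v)"
    using has_derivative_ident by (rule has_derivative_unique)
  then have "inj r'"
    by (intro injI) (metis comp_apply)
  have "smooth_on (y ` W) F"
    using \<phi>(1) d(1) unfolding smooth_map_eucl_iff F_def by auto
  then have F: "(F has_derivative frechet_derivative F (at (r (x p)))) (at (r (x p)))"
    by (intro has_derivative_frechet) (auto intro: smooth_on_imp_differentiable simp: rp d(2))
  have injF: "inj (frechet_derivative F (at (r (x p))))"
    using \<phi>(2) d unfolding immersion_def F_def rp by auto
  have "((F \<circ> r) has_derivative (frechet_derivative F (at (r (x p))) \<circ> r')) (at (x p))"
    by (rule diff_chain_at[OF r F])
  then have "((compose (topspace M) \<phi> \<rho> \<circ> inv_into U x) has_derivative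
      (frechet_derivative F (at (r (x p))) \<circ> r')) (at (x p))"
    by (rule has_derivative_transform_within_open[OF _ S])
      (use U in \<open>auto simp: S_def F_def r_def xi yi compose_eq subset_iff\<close>)
  then have "frechet_derivative (compose (topspace M) \<phi> \<rho> \<circ> inv_into U x) (at (x p)) =
      frechet_derivative F (at (r (x p))) \<circ> r'"
    by (rule frechet_derivative_at[symmetric])
  then show "inj (frechet_derivative (compose (topspace M) \<phi> \<rho> \<circ> inv_into U x) (at (x p)))"
    using inj_compose[OF injF \<open>inj r'\<close>] by simp
qed

lemma Emb_compose_Diff:
  assumes A: "smooth_atlas M A" and \<phi>: "\<phi> \<in> Emb M A" and \<rho>: "\<rho> \<in> Diff M A"
  shows "compose (topspace M) \<phi> \<rho> \<in> Emb M A"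
  unfolding Emb_def
proof (intro CollectI conjI)
  show "compose (topspace M) \<phi> \<rho> \<in> extensional (topspace M)"
    by (rule compose_extensional)
  have "inj_on (\<phi> \<circ> \<rho>) (topspace M)"
    using DiffD(2)[OF \<rho>] EmbD(2)[OF \<phi>] by (auto simp: bij_betw_def intro: comp_inj_on)
  then show "inj_on (compose (topspace M) \<phi> \<rho>) (topspace M)"
    by (rule inj_on_cong[THEN iffD1, rotated]) (simp add: compose_eq)
  show "smooth_map M A euclidean eucl_atlas (compose (topspace M) \<phi> \<rho>)"
    by (rule smooth_map_cong[OF A smooth_atlas_eucl
          smooth_map_compose[OF A A smooth_atlas_eucl DiffD(3)[OF \<rho>] EmbD(3)[OF \<phi>]]])
      (simp add: compose_eq)
  show "immersion A (compose (topspace M) \<phi> \<rho>)"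
    by (rule immersion_compose_Diff[OF A EmbD(3,4)[OF \<phi>] \<rho>])
qed

section \<open>Small perturbations of embeddings\<close>

text \<open>The segments between points of \<open>K\<close> may leave \<open>K\<close>, so the derivative is bounded on a ball around \<open>K\<close>,
  which is convex and compact.\<close>

lemma smooth_Lipschitz_on_bounded:
  fixes V :: "'e::euclidean_space \<Rightarrow> 'f::real_normed_vector"
  assumes V: "smooth_on UNIV V" and "bounded K"
  shows "\<exists>L>0. (\<forall>a\<in>K. \<forall>b\<in>K. norm (V a - V b) \<le> L * norm (a - b)) \<and>
    (\<forall>a\<in>K. \<forall>w. norm (frechet_derivative V (at a) w) \<le> L * norm w)"
proof -
  obtain R where R: "K \<subseteq> cball 0 R"
    using \<open>bounded K\<close> unfolding bounded_iff by (metis mem_cball_0 subsetI)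
  define g where "g = (\<lambda>a. \<Sum>b\<in>Basis. norm (frechet_derivative V (at a) b))"
  have "continuous_on (cball 0 R) g"
    unfolding g_def
    by (intro continuous_intros continuous_at_imp_continuous_on ballI differentiable_imp_continuous_within
        smooth_on_imp_differentiable[OF smooth_on_deriv[OF V]]) auto
  then have "bounded (g ` cball 0 R)"
    by (intro compact_imp_bounded compact_continuous_image compact_cball)
  then obtain B where B: "\<And>a. a \<in> cball 0 R \<Longrightarrow> g a \<le> B"
    unfolding bounded_iff by (metis image_eqI real_norm_def abs_le_D1)
  define L where "L = max 1 B"
  have V': "(V has_derivative frechet_derivative V (at a)) (at a)" for a
    by (intro has_derivative_frechet smooth_on_imp_differentiable[OF V]) auto
  have L: "onorm (frechet_derivative V (at a)) \<le> L" if "a \<in> cball 0 R" for a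
  proof -
    have "onorm (frechet_derivative V (at a)) \<le> g a"
      unfolding g_def by (rule onorm_componentwise[OF has_derivative_bounded_linear[OF V']])
    then show ?thesis
      using B[OF that] by (simp add: L_def)
  qed
  show ?thesis
  proof (intro exI[of _ L] conjI ballI allI)
    show "L > 0" by (simp add: L_def)
    show "norm (V a - V b) \<le> L * norm (a - b)" if "a \<in> K" "b \<in> K" for a b
      by (rule differentiable_bound[OF convex_cball[of 0 R] has_derivative_at_withinI[OF V'] L])
        (use that R in auto)
    show "norm (frechet_derivative V (at a) w) \<le> L * norm w" if "a \<in> K" for a w
    proof -
      have "norm (frechet_derivative V (at a) w) \<le> onorm (frechet_derivative V (at a)) * norm w"
        by (rule onorm[OF has_derivative_bounded_linear[OF V']])
      also have "\<dots> \<le> L * norm w"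
        using L that R by (intro mult_right_mono) auto
      finally show ?thesis .
    qed
  qed
qed

lemma immersion_postcompose:
  fixes \<phi> :: "'a \<Rightarrow> real ^ 'm::finite"
  assumes A: "smooth_atlas M A"
    and \<phi>: "smooth_map M A euclidean eucl_atlas \<phi>" "immersion A \<phi>"
    and h: "\<And>p. p \<in> topspace M \<Longrightarrow> (h has_derivative h' p) (at (\<phi> p))"
    and inj: "\<And>p. p \<in> topspace M \<Longrightarrow> inj (h' p)"
    and \<psi>: "\<And>p. p \<in> topspace M \<Longrightarrow> \<psi> p = h (\<phi> p)"
  shows "immersion A \<psi>"
  unfolding immersion_def
proof clarify
  fix U x p assume c: "(U, x) \<in> A" and p: "p \<in> U"
  note cU = smooth_atlas_chart[OF A c]
  note U = chart_dom_subset[OF cU]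
  note xi = inv_into_chart[OF cU]
  have xU: "open (x ` U)"
    using open_chart_image[OF cU openin_chart_dom[OF cU]] by simp
  define F F' where "F = \<phi> \<circ> inv_into U x" and "F' = frechet_derivative F (at (x p))"
  have "smooth_on (x ` U) F"
    using \<phi>(1) c unfolding smooth_map_eucl_iff F_def by auto
  then have F: "(F has_derivative F') (at (x p))"
    unfolding F'_def using p
    by (intro has_derivative_frechet) (auto intro: smooth_on_imp_differentiable)
  have injF: "inj F'"
    using \<phi>(2) c p unfolding immersion_def F_def F'_def by auto
  have pM: "p \<in> topspace M"
    using p U by auto
  have "(h has_derivative h' p) (at (F (x p)))"
    using h[OF pM] p by (simp add: F_def xi)
  then have "((h \<circ> F) has_derivative (h' p \<circ> F')) (at (x p))"
    by (rule diff_chain_at[OF F])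
  then have "((\<psi> \<circ> inv_into U x) has_derivative (h' p \<circ> F')) (at (x p))"
    by (rule has_derivative_transform_within_open[OF _ xU])
      (use p U in \<open>auto simp: F_def xi \<psi> subset_iff\<close>)
  then have "frechet_derivative (\<psi> \<circ> inv_into U x) (at (x p)) = h' p \<circ> F'"
    by (rule frechet_derivative_at[symmetric])
  then show "inj (frechet_derivative (\<psi> \<circ> inv_into U x) (at (x p)))"
    using inj_compose[OF inj[OF pM] injF] by simp
qed

text \<open>Let \<open>L\<close> be a Lipschitz constant of \<open>V\<close> on the image of \<open>\<phi>\<close> that also bounds the norm of its
  derivative there. If \<open>t * L < 1\<close>, then \<open>a + t V(a) = b + t V(b)\<close> forces \<open>a = b\<close> for
  \<open>a\<close>, \<open>b\<close> in the image, and likewise \<open>w + t V'(a) w = 0\<close> forces \<open>w = 0\<close>.\<close>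

lemma perturb_eventually_Emb:
  fixes \<phi> :: "'a \<Rightarrow> real ^ 'm::finite"
  assumes A: "smooth_atlas M A" and "compact_space M" and \<phi>: "\<phi> \<in> Emb M A" and "V \<in> Cinf"
  shows "\<forall>\<^sub>F t in at_right 0. perturb M V t \<phi> \<in> Emb M A"
proof -
  let ?K = "\<phi> ` topspace M"
  have V: "smooth_on UNIV V"
    using \<open>V \<in> Cinf\<close> by (simp add: Cinf_def)
  have "compactin euclidean ?K"
    using \<open>compact_space M\<close> smooth_mapD(1)[OF EmbD(3)[OF \<phi>]]
    unfolding compact_space_def by (rule image_compactin)
  then have "bounded ?K"
    by (simp add: compactin_euclidean_iff compact_imp_bounded)
  from smooth_Lipschitz_on_bounded[OF V this]
  obtain L where L: "L > 0" "\<forall>a\<in>?K. \<forall>b\<in>?K. norm (V a - V b) \<le> L * norm (a - b)"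
    "\<forall>a\<in>?K. \<forall>w. norm (frechet_derivative V (at a) w) \<le> L * norm w"
    by blast
  have "\<forall>\<^sub>F t in at_right 0. t \<in> {0<..<1 / L}"
    using L(1) by (intro eventually_at_right_real) simp
  then show ?thesis
  proof eventually_elim
    case (elim t)
    then have t: "t > 0" "t * L < 1"
      using L(1) by (auto simp: pos_less_divide_eq)
    have small: "v = 0" if "norm v \<le> t * (L * norm v)" for v :: "real ^ 'm"
    proof (rule ccontr)
      assume "v \<noteq> 0"
      then have "t * L * norm v < 1 * norm v"
        using t(2) by (intro mult_strict_right_mono) auto
      then show False
        using that by simp
    qed
    define h where "h = (\<lambda>z. z + t *\<^sub>R V z)"
    have smooth_h: "smooth_on UNIV h"
      using V unfolding h_def smooth_on_iff_ndiff_on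
      by (intro allI ndiff_on_add ndiff_on_id open_UNIV
          ndiff_on_bounded_linear[OF bounded_linear_scaleR_right]) simp
    have "smooth_map euclidean eucl_atlas euclidean eucl_atlas h"
      unfolding smooth_map_eucl_iff using smooth_h
      by (auto simp: eucl_atlas_def inv_id intro!: continuous_at_imp_continuous_on
          differentiable_imp_continuous_within smooth_on_imp_differentiable)
    then have "smooth_map M A euclidean eucl_atlas (h \<circ> \<phi>)"
      by (rule smooth_map_compose[OF A smooth_atlas_eucl smooth_atlas_eucl EmbD(3)[OF \<phi>]])
    then have smooth: "smooth_map M A euclidean eucl_atlas (perturb M V t \<phi>)"
      by (rule smooth_map_cong[OF A smooth_atlas_eucl]) (simp add: perturb_def h_def)
    have "inj_on h ?K"
    proof (rule inj_onI)
      fix a b assume ab: "a \<in> ?K" "b \<in> ?K" "h a = h b"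
      then have "a - b = t *\<^sub>R (V b - V a)"
        by (simp add: h_def algebra_simps)
      then have "norm (a - b) \<le> t * (L * norm (a - b))"
        using L(2)[rule_format, OF ab(2,1)] t(1) by (simp add: norm_minus_commute)
      then show "a = b"
        using small by fastforce
    qed
    then have "inj_on (h \<circ> \<phi>) (topspace M)"
      by (rule comp_inj_on[OF EmbD(2)[OF \<phi>]])
    then have inj: "inj_on (perturb M V t \<phi>) (topspace M)"
      by (rule inj_on_cong[THEN iffD1, rotated]) (simp add: perturb_def h_def)
    have "immersion A (perturb M V t \<phi>)"
    proof (rule immersion_postcompose[OF A EmbD(3,4)[OF \<phi>]])
      fix p assume p: "p \<in> topspace M"
      let ?h' = "\<lambda>w. w + t *\<^sub>R frechet_derivative V (at (\<phi> p)) w"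
      have "V differentiable at (\<phi> p)"
        using V by (auto intro: smooth_on_imp_differentiable)
      then show h: "(h has_derivative ?h') (at (\<phi> p))"
        unfolding h_def
        by (intro has_derivative_add has_derivative_ident has_derivative_scaleR_right
            has_derivative_frechet)
      have "w = 0" if "?h' w = 0" for w
      proof -
        have "w = - (t *\<^sub>R frechet_derivative V (at (\<phi> p)) w)"
          using that by (simp add: eq_neg_iff_add_eq_0)
        then have "norm w = norm (t *\<^sub>R frechet_derivative V (at (\<phi> p)) w)"
          by (metis norm_minus_cancel)
        also have "\<dots> \<le> t * (L * norm w)"
          using L(3) t(1) p by auto
        finally show ?thesis by (rule small)
      qed
      then show "inj ?h'"
        unfolding linear_injective_0[OF has_derivative_linear[OF h]] by blast
    qed (simp add: perturb_def h_def)
    then show ?case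
      using smooth inj by (simp add: Emb_def perturb_def)
  qed
qed

section \<open>Shape functionals as invariant pre-shape functionals\<close>

lemma Be_eq: "Be M A = proj M A ` (Emb M A :: ('a \<Rightarrow> real ^ 'm::finite) set)"
  by (auto simp: Be_def quotient_def proj_def)

lemma canonical_extension_apply:
  "\<phi> \<in> Emb M A \<Longrightarrow> canonical_extension M A J \<phi> = J (proj M A \<phi>)"
  by (simp add: canonical_extension_def compose_eq)

lemma canonical_extension_in:
  "canonical_extension M A J \<in> preshape_functionals M A"
  by (simp add: preshape_functionals_def canonical_extension_def PiE_def compose_extensional)

context
  fixes M :: "'a topology" and A :: "('a, 'n::finite) chart set"
  assumes A: "smooth_atlas M A" and K: "compact_space M"
begin

lemma proj_eq:
  fixes \<phi> :: "'a \<Rightarrow> real ^ 'm::finite"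
  assumes "\<phi> \<in> Emb M A"
  shows "proj M A \<phi> = {\<psi> \<in> Emb M A. \<psi> ` topspace M = \<phi> ` topspace M}"
  using assms unfolding proj_def Image_singleton reparam_iff[OF A K]
  by (intro Collect_cong) metis

lemma shape_set_proj:
  fixes \<phi> :: "'a \<Rightarrow> real ^ 'm::finite"
  assumes "\<phi> \<in> Emb M A"
  shows "shape_set M (proj M A \<phi>) = \<phi> ` topspace M"
  using assms by (auto simp: shape_set_def proj_eq)

text \<open>The description by image sets makes the definite choice in \<open>shape_of_set\<close> well-defined.\<close>

lemma shape_of_set_image:
  fixes \<phi> :: "'a \<Rightarrow> real ^ 'm::finite"
  assumes "\<phi> \<in> Emb M A"
  shows "shape_of_set M A (\<phi> ` topspace M) = proj M A \<phi>"
  unfolding shape_of_set_def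
proof (rule the_equality)
  show "proj M A \<phi> \<in> Be M A \<and> shape_set M (proj M A \<phi>) = \<phi> ` topspace M"
    using assms by (simp add: Be_eq shape_set_proj)
next
  fix b assume "b \<in> Be M A \<and> shape_set M b = \<phi> ` topspace M"
  then obtain \<psi> where "\<psi> \<in> Emb M A" "b = proj M A \<psi>" "\<psi> ` topspace M = \<phi> ` topspace M"
    unfolding Be_eq using shape_set_proj by blast
  then show "b = proj M A \<phi>"
    using assms by (simp add: proj_eq)
qed

lemma shape_functionality_canonical_extension:
  fixes J :: "('a, 'm::finite) shape \<Rightarrow> real"
  shows "shape_functionality M A (canonical_extension M A J)"
  unfolding shape_functionality_def
proof (intro ballI)
  fix \<phi> :: "'a \<Rightarrow> real ^ 'm" and \<rho> assume \<phi>: "\<phi> \<in> Emb M A" and \<rho>: "\<rho> \<in> Diff M A"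
  then show "canonical_extension M A J (compose (topspace M) \<phi> \<rho>) = canonical_extension M A J \<phi>"
    using Emb_compose_Diff[OF A \<phi> \<rho>]
    by (simp add: canonical_extension_apply proj_eq image_compose_Diff[OF \<rho>])
qed

text \<open>The inverse sends \<open>F\<close> to its value at an arbitrary representative of the shape. Two representatives
  differ by a diffeomorphism, so shape functionality makes the choice immaterial.\<close>

lemma bij_betw_canonical_extension:
  "bij_betw (canonical_extension M A)
     (shape_functionals M A :: (('a, 'm::finite) shape \<Rightarrow> real) set)
     {F \<in> preshape_functionals M A. shape_functionality M A F}"
proof (rule bij_betw_imageI)
  show "inj_on (canonical_extension M A) (shape_functionals M A :: (('a, 'm) shape \<Rightarrow> real) set)"
  proof (rule inj_onI)
    fix J J' :: "('a, 'm) shape \<Rightarrow> real"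
    assume J: "J \<in> shape_functionals M A" "J' \<in> shape_functionals M A"
      and eq: "canonical_extension M A J = canonical_extension M A J'"
    show "J = J'"
    proof (rule PiE_ext[OF J[unfolded shape_functionals_def]])
      fix b :: "('a, 'm) shape" assume "b \<in> Be M A"
      then show "J b = J' b"
        using fun_cong[OF eq] by (auto simp: Be_eq canonical_extension_apply[symmetric])
    qed
  qed
  show "canonical_extension M A ` (shape_functionals M A :: (('a, 'm) shape \<Rightarrow> real) set) =
    {F \<in> preshape_functionals M A. shape_functionality M A F}"
  proof (intro subset_antisym subsetI)
    fix F :: "('a \<Rightarrow> real ^ 'm) \<Rightarrow> real"
    assume "F \<in> {F \<in> preshape_functionals M A. shape_functionality M A F}"
    then have F: "F \<in> preshape_functionals M A" "shape_functionality M A F" by auto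
    define J where "J = (\<lambda>b\<in>Be M A. F (SOME \<psi>. \<psi> \<in> b))"
    have "canonical_extension M A J \<phi> = F \<phi>" if \<phi>: "\<phi> \<in> Emb M A" for \<phi>
    proof -
      define \<psi> where "\<psi> = (SOME \<psi>. \<psi> \<in> proj M A \<phi>)"
      have "\<phi> \<in> proj M A \<phi>"
        using \<phi> by (simp add: proj_eq)
      then have "\<psi> \<in> proj M A \<phi>"
        unfolding \<psi>_def by (rule someI[where P="\<lambda>\<psi>. \<psi> \<in> proj M A \<phi>"])
      then have "\<psi> \<in> Emb M A" "\<phi> ` topspace M = \<psi> ` topspace M"
        using \<phi> by (auto simp: proj_eq)
      then obtain \<rho> where "\<rho> \<in> Diff M A" "\<psi> = compose (topspace M) \<phi> \<rho>"
        using Emb_same_image_Diff[OF A K \<phi>] by blast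
      then have "F \<psi> = F \<phi>"
        using F(2) \<phi> by (simp add: shape_functionality_def)
      then show ?thesis
        using \<phi> by (simp add: canonical_extension_apply J_def Be_eq \<psi>_def)
    qed
    then have "canonical_extension M A J = F"
      by (rule PiE_ext[OF canonical_extension_in[unfolded preshape_functionals_def]
            F(1)[unfolded preshape_functionals_def]])
    moreover have "J \<in> shape_functionals M A"
      by (simp add: shape_functionals_def J_def)
    ultimately show "F \<in> canonical_extension M A ` shape_functionals M A"
      by blast
  qed (auto simp: canonical_extension_in shape_functionality_canonical_extension)
qed

text \<open>The perturbed embedding parametrizes the perturbed shape, so for all small \<open>t\<close> the two difference
  quotients coincide.\<close>

lemma preshape_differentiable_canonical_extension:
  fixes J :: "('a, 'm::finite) shape \<Rightarrow> real"
  assumes "shape_differentiable M A J"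
  shows "preshape_differentiable M A (canonical_extension M A J)"
  unfolding preshape_differentiable_def
proof
  fix \<phi> :: "'a \<Rightarrow> real ^ 'm" assume \<phi>: "\<phi> \<in> Emb M A"
  let ?\<Gamma> = "\<phi> ` topspace M"
  have "?\<Gamma> \<in> shape_set M ` Be M A"
    unfolding Be_eq using imageI[OF imageI[OF \<phi>]] by (metis shape_set_proj[OF \<phi>])
  then obtain D where D: "has_shape_derivative M A J ?\<Gamma> D"
    using assms unfolding shape_differentiable_def by blast
  have "has_preshape_derivative M A (canonical_extension M A J) \<phi> D"
    unfolding has_preshape_derivative_def
  proof (intro conjI ballI)
    show "bounded_linear_functional D"
      using D by (simp add: has_shape_derivative_def)
    fix V :: "real ^ 'm \<Rightarrow> real ^ 'm" assume V: "V \<in> Cinf"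
    show ev: "\<forall>\<^sub>F t in at_right 0. perturb M V t \<phi> \<in> Emb M A"
      by (rule perturb_eventually_Emb[OF A K \<phi> V])
    have "((\<lambda>t. (J (shape_of_set M A (perturb_set V t ?\<Gamma>)) - J (shape_of_set M A ?\<Gamma>)) / t)
        \<longlongrightarrow> D V) (at_right 0)"
      using D V by (simp add: has_shape_derivative_def)
    moreover have "\<forall>\<^sub>F t in at_right 0.
        (J (shape_of_set M A (perturb_set V t ?\<Gamma>)) - J (shape_of_set M A ?\<Gamma>)) / t =
        (canonical_extension M A J (perturb M V t \<phi>) - canonical_extension M A J \<phi>) / t"
      using ev
    proof eventually_elim
      case (elim t)
      have "perturb_set V t ?\<Gamma> = perturb M V t \<phi> ` topspace M"
        by (auto simp: perturb_set_def perturb_def)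
      then show ?case
        using elim \<phi> by (simp add: shape_of_set_image canonical_extension_apply)
    qed
    ultimately show "((\<lambda>t. (canonical_extension M A J (perturb M V t \<phi>) -
        canonical_extension M A J \<phi>) / t) \<longlongrightarrow> D V) (at_right 0)"
      by (rule Lim_transform_eventually)
  qed
  then show "\<exists>D. has_preshape_derivative M A (canonical_extension M A J) \<phi> D"
    by (rule exI[of _ D])
qed

end

theorem proposition1:
  fixes M :: "'a topology" and A :: "('a, 'n::finite) chart set"
  assumes "CARD('m::finite) = CARD('n) + 1"
    and "smooth_manifold M A"
    and "orientable M A"
    and "path_connected_space M"
    and "compact_space M"
  shows "(\<forall>J \<in> (shape_functionals M A :: (('a, 'm) shape \<Rightarrow> real) set).
            canonical_extension M A J \<in> preshape_functionals M A \<and>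
            (\<forall>\<phi>\<in>Emb M A. canonical_extension M A J \<phi> = J (proj M A \<phi>)))
       \<and> bij_betw (canonical_extension M A)
            (shape_functionals M A :: (('a, 'm) shape \<Rightarrow> real) set)
            {F \<in> preshape_functionals M A. shape_functionality M A F}
       \<and> (\<forall>J \<in> (shape_functionals M A :: (('a, 'm) shape \<Rightarrow> real) set).
            shape_differentiable M A J \<longrightarrow> preshape_differentiable M A (canonical_extension M A J))"
proof -
  have "smooth_atlas M A"
    using assms(2) by (simp add: smooth_manifold_def)
  note hyps = this \<open>compact_space M\<close>
  show ?thesis
  proof (intro conjI ballI impI)
    fix J :: "('a, 'm) shape \<Rightarrow> real" and \<phi> :: "'a \<Rightarrow> real ^ 'm"
    show "canonical_extension M A J \<in> preshape_functionals M A"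
      by (rule canonical_extension_in)
    show "canonical_extension M A J \<phi> = J (proj M A \<phi>)" if "\<phi> \<in> Emb M A"
      using that by (rule canonical_extension_apply)
    show "preshape_differentiable M A (canonical_extension M A J)" if "shape_differentiable M A J"
      using that by (rule preshape_differentiable_canonical_extension[OF hyps])
  qed (rule bij_betw_canonical_extension[OF hyps])
qed

end
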